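(* Let $r$ and $k$ be integers with $3\le k\le r$, and let $n$ be a positive integer. Let $H$ be a linear $r$-uniform hypergraph on $n$ vertices which contains no copy of $C_{1,k}^r$ as a subhypergraph, and let $s$ be the number of vertices of $H$ of degree at least $(k-1)(r-1)+2$. Then $$|E(H)|\le \frac{\big((k-1)(r-1)+1\big)(n-s)}{r}.$$ Equivalently, $ex_r^{\mathrm{lin}}(n,C^r_{1,k}) \le \frac{((k-1)(r-1)+1)(n-s)}{r}$, where $s$ is the number of vertices of degree at least $(k-1)(r-1)+2$ in the hypergraph under consideration.
   Context: An $r$-uniform hypergraph ($r$-graph) is linear if every pair of vertices lies in at most one edge. The degree $d(v)$ of a vertex is the number of edges containing it. For $1\le k\le r$, the $k$-crown $C_{1,k}^r$ is the linear $r$-graph consisting of one base edge $e$ together with $k$ pairwise disjoint edges $e_1,\dots,e_k$, each intersecting $e$ in exactly one vertex, these $k$ vertices being distinct. For a family $\mathcal F$ of $r$-graphs, $ex_r^{\mathrm{lin}}(n,\mathcal F)$ denotes the maximum number of edges in an $\mathcal F$-free linear $r$-graph on $n$ vertices. *)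

theory Defs
  imports Complex_Main
begin

type_synonym 'a hypergraph = "'a set \<times> 'a set set"

abbreviation verts :: "'a hypergraph \<Rightarrow> 'a set" where
  "verts H \<equiv> fst H"

abbreviation edges :: "'a hypergraph \<Rightarrow> 'a set set" where
  "edges H \<equiv> snd H"

definition r_graph :: "nat \<Rightarrow> 'a hypergraph \<Rightarrow> bool" where
  "r_graph r H \<longleftrightarrow> finite (verts H) \<and> (\<forall>e\<in>edges H. e \<subseteq> verts H \<and> card e = r)"

definition linear_hypergraph :: "'a hypergraph \<Rightarrow> bool" where
  "linear_hypergraph H \<longleftrightarrow>
     (\<forall>x\<in>verts H. \<forall>y\<in>verts H. x \<noteq> y \<longrightarrow>
        (\<forall>e\<in>edges H. \<forall>f\<in>edges H. {x, y} \<subseteq> e \<and> {x, y} \<subseteq> f \<longrightarrow> e = f))"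

definition degree :: "'a hypergraph \<Rightarrow> 'a \<Rightarrow> nat" where
  "degree H v = card {e \<in> edges H. v \<in> e}"

text \<open>
  All labelled representatives of the crown with vertices in the given type: \<open>e\<close> is the base edge
  and \<open>F\<close> the set of the \<open>k\<close> attached edges. Injectivity says that the attachment
  vertices are distinct. There are no isolated vertices.
\<close>
definition crowns :: "nat \<Rightarrow> nat \<Rightarrow> 'a hypergraph set" where
  "crowns r k = {C. r_graph r C \<and> linear_hypergraph C \<and> verts C = \<Union>(edges C) \<and>
     (\<exists>e F. edges C = insert e F \<and> e \<notin> F \<and> finite F \<and> card F = k \<and>
        pairwise disjnt F \<and> (\<forall>f\<in>F. card (f \<inter> e) = 1) \<and> inj_on (\<lambda>f. f \<inter> e) F)}"

text \<open>Containment as a not necessarily induced subhypergraph, up to isomorphism.\<close>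
definition contains_copy :: "'a hypergraph \<Rightarrow> 'b hypergraph \<Rightarrow> bool" where
  "contains_copy H C \<longleftrightarrow>
     (\<exists>\<phi>. inj_on \<phi> (verts C) \<and> \<phi> ` verts C \<subseteq> verts H \<and> (\<forall>e\<in>edges C. \<phi> ` e \<in> edges H))"

definition free_of :: "'b hypergraph set \<Rightarrow> 'a hypergraph \<Rightarrow> bool" where
  "free_of \<F> H \<longleftrightarrow> (\<forall>C\<in>\<F>. \<not> contains_copy H C)"

text \<open>Every finite hypergraph is isomorphic to one whose vertices are natural numbers, so
  maximising over hypergraphs on \<^typ>\<open>nat\<close> loses nothing.\<close>
definition ex_lin :: "nat \<Rightarrow> nat \<Rightarrow> 'b hypergraph set \<Rightarrow> nat" where
  "ex_lin r n \<F> = Max {card (edges H) | H :: nat hypergraph.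
     r_graph r H \<and> linear_hypergraph H \<and> card (verts H) = n \<and> free_of \<F> H}"

end

theory Submission
  imports Defs
begin

text \<open>
  Give every vertex \<open>v\<close> of degree at most \<open>D = (k - 1)(r - 1) + 1\<close> total weight at most 1,
  split equally among its edges. It suffices that each edge receives weight at least
  \<open>r / D\<close>. Order the vertices of an edge \<open>e\<close> by degree. If the \<open>k\<close> largest degrees
  were at least \<open>2, (r - 1) + 2, \<dots>, (k - 1)(r - 1) + 2\<close>, then a crown with base \<open>e\<close> could
  be built greedily. So for some \<open>i < k\<close> there are \<open>r - k + i + 1\<close> vertices in \<open>e\<close> of degree
  at most \<open>i(r - 1) + 1\<close>, and these alone contribute enough weight.
\<close>

section \<open>Elementary facts on linear hypergraphs\<close>

lemma linear_hypergraphD: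
  assumes "linear_hypergraph H" "r_graph r H" "e \<in> edges H" "f \<in> edges H"
    and "x \<in> e" "y \<in> e" "x \<in> f" "y \<in> f" "x \<noteq> y"
  shows "e = f"
proof -
  have "x \<in> verts H" "y \<in> verts H"
    using assms unfolding r_graph_def by blast+
  then show ?thesis
    using assms unfolding linear_hypergraph_def by blast
qed

lemma r_graph_finite_edges: "r_graph r H \<Longrightarrow> finite (edges H)"
  unfolding r_graph_def by (meson Pow_iff finite_Pow_iff finite_subset subsetI)

lemma r_graph_finite_edge: "r_graph r H \<Longrightarrow> e \<in> edges H \<Longrightarrow> finite e"
  unfolding r_graph_def by (meson finite_subset)

lemma card_edges_through_pair_le_1:
  assumes "linear_hypergraph H" "r_graph r H" "x \<noteq> y"
  shows "card {g \<in> edges H. x \<in> g \<and> y \<in> g} \<le> 1"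
  using linear_hypergraphD[OF assms(1,2)] assms(3)
  by (intro card_le_Suc0_iff_eq[THEN iffD2, folded One_nat_def])
    (auto simp: r_graph_finite_edges[OF assms(2)])

section \<open>Building a crown greedily on a base edge\<close>

text \<open>When the edge at \<open>w m\<close> is chosen, each vertex of an earlier
  \<open>f i\<close> other than \<open>w i\<close> rules out at most one edge through
  \<open>w m\<close>, by linearity. With \<open>e\<close> itself this makes at most
  \<open>m * (r - 1) + 1\<close> forbidden edges, one fewer than the assumed degree.\<close>

lemma greedy_disjoint_edges:
  assumes lin: "linear_hypergraph H" and rg: "r_graph r H" and e: "e \<in> edges H"
    and inj: "inj_on w {..<m}" and we: "w ` {..<m} \<subseteq> e"
    and deg: "\<And>i. i < m \<Longrightarrow> degree H (w i) \<ge> i * (r - 1) + 2"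
  shows "\<exists>f. (\<forall>i<m. f i \<in> edges H \<and> f i \<noteq> e \<and> w i \<in> f i) \<and>
    (\<forall>i<m. \<forall>j<m. i \<noteq> j \<longrightarrow> f i \<inter> f j = {})"
  using inj we deg
proof (induction m)
  case 0
  show ?case by simp
next
  case (Suc m)
  have "inj_on w {..<m}" "w ` {..<m} \<subseteq> e"
    using Suc.prems(1,2) by (auto simp: inj_on_def)
  then obtain f where f: "\<And>i. i < m \<Longrightarrow> f i \<in> edges H \<and> f i \<noteq> e \<and> w i \<in> f i"
    and dj: "\<And>i j. i < m \<Longrightarrow> j < m \<Longrightarrow> i \<noteq> j \<Longrightarrow> f i \<inter> f j = {}"
    using Suc.IH Suc.prems(3) by (metis less_SucI)
  have wm: "w m \<in> e" and wi: "\<And>i. i < m \<Longrightarrow> w i \<in> e \<and> w i \<noteq> w m"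
    using Suc.prems(1,2) by (auto simp: inj_on_def)
  \<comment> \<open>Otherwise \<open>f i\<close> and \<open>e\<close> would share the two vertices
    \<open>w i\<close> and \<open>w m\<close>.\<close>
  have wmf: "w m \<notin> f i" if "i < m" for i
    using linear_hypergraphD[OF lin rg e, of "f i" "w i" "w m"] f wi wm that by metis
  \<comment> \<open>The forbidden edges: \<open>e\<close>, and every edge through \<open>w m\<close>
    that meets an earlier \<open>f i\<close> outside \<open>w i\<close>. The vertex
    \<open>w i\<close> can be left out, since only \<open>e\<close> joins it to \<open>w m\<close>;
    this keeps the count at \<open>r - 1\<close> per earlier edge.\<close>
  define B where "B = insert e (\<Union>i<m. \<Union>u\<in>f i - {w i}. {g \<in> edges H. w m \<in> g \<and> u \<in> g})"
  have cf: "card (f i - {w i}) = r - 1" if "i < m" for i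
    using rg f[OF that] by (simp add: r_graph_def)
  have "card (\<Union>u\<in>f i - {w i}. {g \<in> edges H. w m \<in> g \<and> u \<in> g}) \<le> r - 1" if "i < m" for i
  proof -
    have "card (\<Union>u\<in>f i - {w i}. {g \<in> edges H. w m \<in> g \<and> u \<in> g})
        \<le> (\<Sum>u\<in>f i - {w i}. card {g \<in> edges H. w m \<in> g \<and> u \<in> g})"
      using r_graph_finite_edge[OF rg] f that by (intro card_UN_le) auto
    also have "\<dots> \<le> (\<Sum>u\<in>f i - {w i}. 1)"
      using wmf that by (intro sum_mono card_edges_through_pair_le_1[OF lin rg]) auto
    finally show ?thesis using cf[OF that] by simp
  qed
  then have "(\<Sum>i<m. card (\<Union>u\<in>f i - {w i}. {g \<in> edges H. w m \<in> g \<and> u \<in> g})) \<le> m * (r - 1)"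
    using sum_bounded_above[of "{..<m}"
        "\<lambda>i. card (\<Union>u\<in>f i - {w i}. {g \<in> edges H. w m \<in> g \<and> u \<in> g})" "r - 1"] by simp
  then have "card (\<Union>i<m. \<Union>u\<in>f i - {w i}. {g \<in> edges H. w m \<in> g \<and> u \<in> g}) \<le> m * (r - 1)"
    using card_UN_le[of "{..<m}"
        "\<lambda>i. \<Union>u\<in>f i - {w i}. {g \<in> edges H. w m \<in> g \<and> u \<in> g}"] by simp
  then have "card B \<le> m * (r - 1) + 1"
    unfolding B_def
    using card_insert_le_m1[of "m * (r - 1) + 1"] by simp
  then have "card B < card {g \<in> edges H. w m \<in> g}"
    using Suc.prems(3)[of m] unfolding degree_def by simp
  moreover have "finite B"
    unfolding B_def
    using r_graph_finite_edges[OF rg] r_graph_finite_edge[OF rg] f by auto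
  ultimately obtain g where g: "g \<in> edges H" "w m \<in> g" "g \<notin> B"
    by (metis (mono_tags, lifting) card_mono leD mem_Collect_eq subsetI)
  then have ge: "g \<noteq> e" and gu: "\<And>i u. i < m \<Longrightarrow> u \<in> f i \<Longrightarrow> u \<noteq> w i \<Longrightarrow> u \<notin> g"
    unfolding B_def by auto
  \<comment> \<open>The case omitted from \<open>B\<close>: an edge containing both
    \<open>w i\<close> and \<open>w m\<close> is \<open>e\<close>.\<close>
  have gw: "w i \<notin> g" if "i < m" for i
    using linear_hypergraphD[OF lin rg e g(1), of "w i" "w m"] wi wm that g(2) ge by metis
  have gdj: "f i \<inter> g = {}" "g \<inter> f i = {}" if "i < m" for i
    using gu gw that by blast+
  show ?case
    using f dj g ge gdj
    by (intro exI[of _ "f(m := g)"]) (auto simp: less_Suc_eq)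
qed

text \<open>The greedy edges differ from \<open>e\<close>, so by linearity each meets
  \<open>e\<close> in its own \<open>w i\<close> only; together with \<open>e\<close> they form the
  crown.\<close>

lemma crown_at_edge:
  assumes lin: "linear_hypergraph H" and rg: "r_graph r H" and e: "e \<in> edges H"
    and inj: "inj_on w {..<k}" and we: "w ` {..<k} \<subseteq> e"
    and deg: "\<And>i. i < k \<Longrightarrow> degree H (w i) \<ge> i * (r - 1) + 2"
  obtains C where "C \<in> crowns r k" "verts C \<subseteq> verts H" "edges C \<subseteq> edges H"
proof -
  obtain f where f: "\<And>i. i < k \<Longrightarrow> f i \<in> edges H \<and> f i \<noteq> e \<and> w i \<in> f i"
    and dj: "\<And>i j. i < k \<Longrightarrow> j < k \<Longrightarrow> i \<noteq> j \<Longrightarrow> f i \<inter> f j = {}"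
    using greedy_disjoint_edges[OF lin rg e inj we deg] by metis
  have fe: "f i \<inter> e = {w i}" if "i < k" for i
  proof -
    have "w i \<in> e" using we that by blast
    then show ?thesis
      using linear_hypergraphD[OF lin rg e, of "f i" "w i"] f[OF that] by blast
  qed
  have injf: "inj_on f {..<k}"
    using dj f by (intro inj_onI) (metis disjoint_iff lessThan_iff)
  define F where "F = f ` {..<k}"
  define C where "C = (\<Union>(insert e F), insert e F)"
  have sub: "insert e F \<subseteq> edges H"
    using e f unfolding F_def by auto
  have vsub: "\<Union>(insert e F) \<subseteq> verts H"
    using sub rg unfolding r_graph_def by blast
  have "r_graph r C"
    using rg sub vsub unfolding r_graph_def C_def fst_conv snd_conv
    by (meson Union_upper finite_subset subsetD)
  moreover have "linear_hypergraph C"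
    using lin sub vsub unfolding linear_hypergraph_def C_def fst_conv snd_conv
    by (meson subsetD)
  moreover have "e \<notin> F" "finite F" "card F = k"
    using f injf by (auto simp: F_def card_image)
  moreover have "pairwise disjnt F"
    using dj unfolding F_def pairwise_def disjnt_def by auto
  moreover have "\<forall>g\<in>F. card (g \<inter> e) = 1"
    using fe unfolding F_def by auto
  moreover have "inj_on (\<lambda>g. g \<inter> e) F"
    using fe inj unfolding F_def inj_on_def by auto
  ultimately have "C \<in> crowns r k"
    unfolding crowns_def by (auto simp: C_def)
  then show ?thesis
    using that sub vsub unfolding C_def by simp
qed

section \<open>Relabelling crowns by natural numbers\<close>

text \<open>Freeness is stated for crowns on \<open>nat\<close>, whereas the greedy crown has
  vertices of type \<open>'a\<close>. An injective relabelling commutes with intersections of edges,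
  so all conditions on a crown survive.\<close>

lemma crowns_image:
  assumes C: "C \<in> crowns r k" and inj: "inj_on g (verts C)"
  shows "(g ` verts C, (`) g ` edges C) \<in> crowns r k"
proof -
  obtain e F where rg: "r_graph r C" and lin: "linear_hypergraph C"
    and V: "verts C = \<Union>(edges C)"
    and E: "edges C = insert e F" and F: "e \<notin> F" "finite F" "card F = k" "pairwise disjnt F"
      "\<forall>f\<in>F. card (f \<inter> e) = 1" "inj_on (\<lambda>f. f \<inter> e) F"
    using C unfolding crowns_def by blast
  have sub: "f \<subseteq> verts C" if "f \<in> edges C" for f
    using V that by blast
  \<comment> \<open>Injectivity on the level of edges preserves \<open>e \<notin> F\<close> and the
    number of attached edges.\<close>
  have injI: "inj_on ((`) g) (Pow (verts C))"
    using inj by (rule inj_on_image_Pow)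
  have Fsub: "F \<subseteq> Pow (verts C)" "e \<in> Pow (verts C)"
    using sub E by auto
  have int: "g ` f \<inter> g ` e = g ` (f \<inter> e)" if "f \<in> F" for f
    using inj_on_image_Int[OF inj, of f e] sub E that by auto
  have "r_graph r (g ` verts C, (`) g ` edges C)"
    using rg inj unfolding r_graph_def
    by (auto simp: card_image inj_on_subset)
  moreover have "linear_hypergraph (g ` verts C, (`) g ` edges C)"
    unfolding linear_hypergraph_def fst_conv snd_conv
  proof (intro ballI impI)
    fix x y e' f' assume "x \<in> g ` verts C" "y \<in> g ` verts C" and ne: "x \<noteq> y"
      and "e' \<in> (`) g ` edges C" "f' \<in> (`) g ` edges C" and xy: "{x, y} \<subseteq> e' \<and> {x, y} \<subseteq> f'"
    then obtain a b p q where ab: "x = g a" "y = g b" "a \<in> verts C" "b \<in> verts C"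
      and pq: "e' = g ` p" "f' = g ` q" "p \<in> edges C" "q \<in> edges C" by blast
    have "a \<in> p" "b \<in> p" "a \<in> q" "b \<in> q"
      using xy ab pq inj_on_image_mem_iff[OF inj] sub by auto
    then show "e' = f'"
      using linear_hypergraphD[OF lin rg, of p q a b] pq ab ne by blast
  qed
  moreover have "g ` verts C = \<Union>((`) g ` edges C)"
    using V by auto
  moreover have "(`) g ` edges C = insert (g ` e) ((`) g ` F)"
    using E by simp
  moreover have "g ` e \<notin> (`) g ` F"
    using F(1) inj_on_image_mem_iff[OF injI Fsub(2,1)] by simp
  moreover have "finite ((`) g ` F)" "card ((`) g ` F) = k"
    using F inj_on_subset[OF injI Fsub(1)] by (auto simp: card_image)
  moreover have "pairwise disjnt ((`) g ` F)"
  proof (rule pairwiseI)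
    fix p' q' assume "p' \<in> (`) g ` F" "q' \<in> (`) g ` F" "p' \<noteq> q'"
    then obtain p q where pq: "p' = g ` p" "q' = g ` q" "p \<in> F" "q \<in> F" "p \<noteq> q" by blast
    then have "p \<inter> q = {}"
      using F(4) unfolding pairwise_def disjnt_def by blast
    moreover have "g ` p \<inter> g ` q = g ` (p \<inter> q)"
      using inj_on_image_Int[OF inj, of p q] Fsub pq by auto
    ultimately show "disjnt p' q'"
      using pq by (simp add: disjnt_def)
  qed
  moreover have "\<forall>f\<in>(`) g ` F. card (f \<inter> g ` e) = 1"
    using F(5) int Fsub inj
    by (auto simp: card_image inj_on_subset[OF inj] le_infI2)
  moreover have "inj_on (\<lambda>f. f \<inter> g ` e) ((`) g ` F)"
  proof (rule inj_onI)
    fix p' q' assume "p' \<in> (`) g ` F" "q' \<in> (`) g ` F" and eq: "p' \<inter> g ` e = q' \<inter> g ` e"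
    then obtain p q where pq: "p' = g ` p" "q' = g ` q" "p \<in> F" "q \<in> F" by blast
    then have "g ` (p \<inter> e) = g ` (q \<inter> e)"
      using eq int by simp
    then have "p \<inter> e = q \<inter> e"
      using inj_on_image_eq_iff[OF inj, of "p \<inter> e" "q \<inter> e"] Fsub by auto
    then show "p' = q'"
      using F(6) pq by (auto dest: inj_onD)
  qed
  ultimately show ?thesis
    unfolding crowns_def
    by (intro CollectI conjI exI[of _ "g ` e"] exI[of _ "(`) g ` F"]) (simp_all only: fst_conv snd_conv not_False_eq_True)
qed

lemma free_of_crowns_transfer:
  fixes H :: "'a hypergraph" and C :: "'a hypergraph"
  assumes free: "free_of (crowns r k :: nat hypergraph set) H"
    and C: "C \<in> crowns r k"
  shows "\<not> (verts C \<subseteq> verts H \<and> edges C \<subseteq> edges H)"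
proof
  assume sub: "verts C \<subseteq> verts H \<and> edges C \<subseteq> edges H"
  have fin: "finite (verts C)" and V: "verts C = \<Union>(edges C)"
    using C unfolding crowns_def r_graph_def by blast+
  obtain g :: "'a \<Rightarrow> nat" where g: "inj_on g (verts C)"
    using finite_imp_inj_to_nat_seg[OF fin] by blast
  \<comment> \<open>The embedding of the relabelled crown into \<open>H\<close> is the inverse of
    the relabelling.\<close>
  let ?h = "inv_into (verts C) g"
  have h: "?h ` g ` p = p" if "p \<subseteq> verts C" for p
    using that g by (simp add: inv_into_image_cancel)
  have "contains_copy H (g ` verts C, (`) g ` edges C)"
    unfolding contains_copy_def
  proof (intro exI[of _ ?h] conjI)
    show "\<forall>e\<in>edges (g ` verts C, (`) g ` edges C). ?h ` e \<in> edges H"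
    proof
      fix p assume "p \<in> edges (g ` verts C, (`) g ` edges C)"
      then obtain q where "p = g ` q" "q \<in> edges C" by auto
      moreover then have "q \<subseteq> verts C" using V by blast
      ultimately show "?h ` p \<in> edges H" using h sub by auto
    qed
  qed (use h sub in \<open>auto simp: inj_on_inv_into\<close>)
  then show False
    using free crowns_image[OF C g] unfolding free_of_def by blast
qed

section \<open>Degrees and weights inside one edge\<close>

lemma many_small_degrees_in_edge:
  fixes H :: "'a hypergraph"
  assumes lin: "linear_hypergraph H" and rg: "r_graph r H" and e: "e \<in> edges H" and kr: "k \<le> r"
    and free: "free_of (crowns r k :: nat hypergraph set) H"
  obtains i where "i < k" "r - k + i + 1 \<le> card {v \<in> e. degree H v \<le> i * (r - 1) + 1}"
proof -
  have fe: "finite e" and ce: "card e = r"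
    using rg e r_graph_finite_edge unfolding r_graph_def by blast+
  obtain ys where ys: "set ys = e" "distinct ys"
    using finite_distinct_list[OF fe] by blast
  define xs where "xs = sort_key (degree H) ys"
  have xs: "set xs = e" "distinct xs" "length xs = r"
    and sorted: "sorted (map (degree H) xs)"
    using ys ce distinct_card[of ys] by (auto simp: xs_def)
  \<comment> \<open>The last \<open>k\<close> positions of the sorted list: the \<open>k\<close>
    largest degrees in ascending order, matching the ascending thresholds of
    \<open>crown_at_edge\<close>.\<close>
  define w where "w i = xs ! (r - k + i)" for i
  have "inj_on w {..<k}"
    using xs kr by (auto simp: inj_on_def w_def nth_eq_iff_index_eq)
  moreover have "w ` {..<k} \<subseteq> e"
    using xs kr by (auto simp: w_def simp flip: xs(1))
  ultimately have "\<exists>i<k. \<not> degree H (w i) \<ge> i * (r - 1) + 2"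
    using crown_at_edge[OF lin rg e] free_of_crowns_transfer[OF free] by metis
  then obtain i where i: "i < k" "degree H (w i) \<le> i * (r - 1) + 1"
    by auto
  \<comment> \<open>All positions up to that of \<open>w i\<close> carry no larger degree; counting
    from 0, there are \<open>r - k + i + 1\<close> of them.\<close>
  have "(!) xs ` {..r - k + i} \<subseteq> {v \<in> e. degree H v \<le> i * (r - 1) + 1}"
  proof (intro image_subsetI CollectI conjI)
    fix j assume j: "j \<in> {..r - k + i}"
    then show "xs ! j \<in> e"
      using xs i kr by (auto simp flip: xs(1))
    have "degree H (xs ! j) \<le> degree H (w i)"
      using sorted_nth_mono[OF sorted, of j "r - k + i"] j xs i kr by (simp add: w_def)
    then show "degree H (xs ! j) \<le> i * (r - 1) + 1"
      using i by simp
  qed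
  then have "card ((!) xs ` {..r - k + i}) \<le> card {v \<in> e. degree H v \<le> i * (r - 1) + 1}"
    using fe by (intro card_mono) auto
  moreover have "inj_on ((!) xs) {..r - k + i}"
    using xs i kr by (auto simp: inj_on_def nth_eq_iff_index_eq)
  ultimately show ?thesis
    using that[OF i(1)] by (simp add: card_image)
qed

lemma crown_weight_ineq:
  fixes r k i :: nat
  assumes "i < k" "k \<le> r" "2 \<le> r"
  shows "real r / real ((k - 1) * (r - 1) + 1) \<le> real (r - k + i + 1) / real (i * (r - 1) + 1)"
proof -
  obtain j where j: "k = i + j + 1"
    using assms(1) by (metis Suc_eq_plus1 less_imp_Suc_add add_Suc_right)
  obtain c where c: "r = i + j + 1 + c"
    using assms(2) j le_Suc_ex by blast
  \<comment> \<open>After cross-multiplication the two sides differ by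
    \<open>j * ((r - 1) * (c + 1) - 1)\<close>, which is nonnegative because
    \<open>r - 1 = i + j + c\<close> is at least 1.\<close>
  have "j \<le> j * (i + j + c)"
    using assms(3) c by (cases "i + j + c") auto
  then have "r * (i * (r - 1) + 1) \<le> (r - k + i + 1) * ((k - 1) * (r - 1) + 1)"
    unfolding j c by (simp add: algebra_simps)
  then have "real r * real (i * (r - 1) + 1) \<le> real (r - k + i + 1) * real ((k - 1) * (r - 1) + 1)"
    by (metis of_nat_le_iff of_nat_mult)
  then show ?thesis
    using pos_divide_le_eq[of "real ((k - 1) * (r - 1) + 1)"]
      pos_le_divide_eq[of "real (i * (r - 1) + 1)"]
    by (simp only: times_divide_eq_left of_nat_0_less_iff add_gr_0 zero_less_one simp_thms)
qed

lemma edge_weight_ge: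
  fixes H :: "'a hypergraph"
  assumes lin: "linear_hypergraph H" and rg: "r_graph r H" and e: "e \<in> edges H"
    and kr: "k \<le> r" and r: "2 \<le> r"
    and free: "free_of (crowns r k :: nat hypergraph set) H"
  shows "real r / real ((k - 1) * (r - 1) + 1)
    \<le> (\<Sum>v | v \<in> e \<and> degree H v \<le> (k - 1) * (r - 1) + 1. 1 / real (degree H v))"
proof -
  obtain i where i: "i < k" "r - k + i + 1 \<le> card {v \<in> e. degree H v \<le> i * (r - 1) + 1}"
    using many_small_degrees_in_edge[OF lin rg e kr free] by blast
  let ?A = "{v \<in> e. degree H v \<le> i * (r - 1) + 1}"
  have fe: "finite e" using r_graph_finite_edge[OF rg e] .
  \<comment> \<open>Positivity matters for the lower bound on the weights, because
    \<open>1 / 0 = 0\<close>.\<close>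
  have pos: "0 < degree H v" if "v \<in> e" for v
    using that e r_graph_finite_edges[OF rg] by (auto simp: degree_def card_gt_0_iff)
  have "real r / real ((k - 1) * (r - 1) + 1) \<le> real (r - k + i + 1) / real (i * (r - 1) + 1)"
    using crown_weight_ineq i kr r by blast
  also have "\<dots> \<le> real (card ?A) * (1 / real (i * (r - 1) + 1))"
    using i(2) by (simp add: divide_right_mono)
  also have "\<dots> \<le> (\<Sum>v\<in>?A. 1 / real (degree H v))"
    by (intro sum_bounded_below divide_left_mono) (use pos in \<open>auto simp del: of_nat_mult of_nat_add\<close>)
  \<comment> \<open>Raising the threshold from \<open>i\<close> to \<open>k - 1\<close> only adds
    nonnegative terms.\<close>
  also have "\<dots> \<le> (\<Sum>v | v \<in> e \<and> degree H v \<le> (k - 1) * (r - 1) + 1. 1 / real (degree H v))"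
  proof (rule sum_mono2)
    have "i * (r - 1) + 1 \<le> (k - 1) * (r - 1) + 1"
      using i by (intro add_right_mono mult_right_mono) auto
    then show "?A \<subseteq> {v. v \<in> e \<and> degree H v \<le> (k - 1) * (r - 1) + 1}"
      by (blast intro: le_trans)
  qed (use fe in auto)
  finally show ?thesis .
qed

section \<open>Double counting of the weights\<close>

text \<open>Summed over edges, the weight is at least \<open>r / D\<close> per edge, with
  \<open>D = (k - 1) * (r - 1) + 1\<close>; summed over low-degree vertices, it is at most 1 per
  vertex.\<close>

lemma crown_free_card_edges_le:
  fixes H :: "'a hypergraph"
  assumes lin: "linear_hypergraph H" and rg: "r_graph r H"
    and kr: "k \<le> r" and r: "2 \<le> r"
    and free: "free_of (crowns r k :: nat hypergraph set) H"
  shows "real (card (edges H)) * real r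
    \<le> real ((k - 1) * (r - 1) + 1) * real (card {v \<in> verts H. degree H v \<le> (k - 1) * (r - 1) + 1})"
proof -
  let ?D = "(k - 1) * (r - 1) + 1"
  let ?L = "{v \<in> verts H. degree H v \<le> ?D}"
  have fV: "finite (verts H)" and fE: "finite (edges H)"
    using rg r_graph_finite_edges[OF rg] by (auto simp: r_graph_def)
  have "real (card (edges H)) * (real r / real ?D)
      \<le> (\<Sum>e\<in>edges H. \<Sum>v | v \<in> e \<and> degree H v \<le> ?D. 1 / real (degree H v))"
    using edge_weight_ge[OF lin rg _ kr r free] by (intro sum_bounded_below)
  also have "\<dots> = (\<Sum>e\<in>edges H. \<Sum>v | v \<in> ?L \<and> v \<in> e. 1 / real (degree H v))"
    using rg unfolding r_graph_def by (intro sum.cong) (auto intro!: sum.cong)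
  also have "\<dots> = (\<Sum>v\<in>?L. \<Sum>e | e \<in> edges H \<and> v \<in> e. 1 / real (degree H v))"
    using fV fE by (intro sum.swap_restrict) auto
  also have "\<dots> = (\<Sum>v\<in>?L. real (degree H v) / real (degree H v))"
    by (simp add: degree_def)
  \<comment> \<open>The quotient is 1, or 0 at an isolated vertex, hence only an inequality.\<close>
  also have "\<dots> \<le> (\<Sum>v\<in>?L. 1)"
    by (intro sum_mono) auto
  finally have "real (card (edges H)) * (real r / real ?D) \<le> real (card ?L)"
    by simp
  moreover have "0 < real ?D" by (simp only: of_nat_0_less_iff add_gr_0 zero_less_one simp_thms)
  ultimately show ?thesis
    by (simp only: times_divide_eq_right pos_divide_le_eq mult.commute)
qed

theorem theorem5:
  fixes r k n s :: nat and H :: "'a hypergraph"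
  assumes "3 \<le> k" and "k \<le> r" and "0 < n"
    and "r_graph r H" and "linear_hypergraph H" and "card (verts H) = n"
    and "free_of (crowns r k :: nat hypergraph set) H"
    and "s = card {v \<in> verts H. degree H v \<ge> (k - 1) * (r - 1) + 2}"
  shows "real (card (edges H)) \<le> real ((k - 1) * (r - 1) + 1) * (real n - real s) / real r
    \<and> (card (edges H) = ex_lin r n (crowns r k :: nat hypergraph set) \<longrightarrow>
         real (ex_lin r n (crowns r k :: nat hypergraph set))
           \<le> real ((k - 1) * (r - 1) + 1) * (real n - real s) / real r)"
proof -
  let ?D = "(k - 1) * (r - 1) + 1"
  let ?L = "{v \<in> verts H. degree H v \<le> ?D}" and ?S = "{v \<in> verts H. degree H v \<ge> ?D + 1}"
  have fV: "finite (verts H)"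
    using assms(4) by (simp add: r_graph_def)
  \<comment> \<open>As degrees are integers, the thresholds \<open>?D\<close> and
    \<open>?D + 1\<close> split the vertex set, and \<open>?S\<close> has size
    \<open>s\<close>.\<close>
  have "card (?L \<union> ?S) = card ?L + card ?S"
    using fV by (intro card_Un_disjoint) auto
  moreover have "?L \<union> ?S = verts H" by auto
  ultimately have "real (card ?L) = real n - real s"
    using assms(6,8) by simp
  then have "real (card (edges H)) * real r \<le> real ?D * (real n - real s)"
    using crown_free_card_edges_le[OF assms(5,4,2) _ assms(7)] assms(1,2) by simp
  then have "real (card (edges H)) \<le> real ?D * (real n - real s) / real r"
    using assms(1,2) by (subst pos_le_divide_eq) auto
  \<comment> \<open>The second conjunct is the same bound rewritten with its own premise.\<close>
  then show ?thesis by metis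
qed

end
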